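(* Let $G$ be a finite connected graph of order $n$ with maximum degree $\Delta$ and minimum degree $\delta$. Then $$\beta_N^*(G)\geq \begin{cases} \dfrac{1-\Delta}{1+\Delta}\, n & \text{if } \Delta\geq \delta+1 \text{ or } \delta=\Delta\equiv 1 \pmod 2,\\[2mm] \dfrac{\Delta+2-\Delta^2}{\Delta+2+\Delta^2}\, n & \text{otherwise (i.e. } \delta=\Delta\equiv 0 \pmod 2),\end{cases}$$ and these bounds are sharp.
   Context: For a graph $G$ with vertex set $V$ and a vertex $v$, $N(v)$ is the open neighborhood and $N[v]=N(v)\cup\{v\}$ the closed neighborhood. For $f:V\to\mathbb{R}$ and $S\subseteq V$, $f(S)=\sum_{v\in S}f(v)$. A function $f:V\to\{-1,1\}$ is called negative if $f(N[v])\leq 1$ for every $v\in V$. A negative function $f$ is maximal if there is no negative function $g\neq f$ with $g(v)\geq f(v)$ for every $v\in V$. The lower against number $\beta_N^*(G)$ is the minimum of $f(V)$ over all maximal negative functions $f$ of $G$. "Sharp" means that for the stated parameter ranges there exist graphs attaining equality. *)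

theory Defs
  imports Complex_Main "HOL-Library.FuncSet" "Graph_Theory.Graph_Theory"
begin

text \<open>
  A finite simple graph is a \<open>pair_graph\<close>: a finite loop-free symmetric digraph whose arcs are
  pairs of vertices, each undirected edge being represented by its two opposite arcs.
  Connectedness is \<open>Digraph_Component.connected\<close> (it includes nonemptiness of the vertex set);
  the name has to be qualified because of topological connectedness.
\<close>

definition open_nbhd :: "('a, 'b) pre_digraph \<Rightarrow> 'a \<Rightarrow> 'a set" where
  "open_nbhd G v = {u \<in> verts G. v \<rightarrow>\<^bsub>G\<^esub> u}"

definition closed_nbhd :: "('a, 'b) pre_digraph \<Rightarrow> 'a \<Rightarrow> 'a set" where
  "closed_nbhd G v = insert v (open_nbhd G v)"

text \<open>In a symmetric digraph the out-degree is the number of incident undirected edges.\<close>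

definition max_degree :: "('a, 'b) pre_digraph \<Rightarrow> nat" where
  "max_degree G = Max (out_degree G ` verts G)"

definition min_degree :: "('a, 'b) pre_digraph \<Rightarrow> nat" where
  "min_degree G = Min (out_degree G ` verts G)"

text \<open>
  A function on the vertex set is represented by its extensional representative on the whole
  vertex type (\<open>undefined\<close> off the vertex set), so that equality of representatives is
  equality on the vertex set and a finite graph has finitely many such functions.
\<close>

definition negative_fun :: "('a, 'b) pre_digraph \<Rightarrow> ('a \<Rightarrow> real) \<Rightarrow> bool" where
  "negative_fun G f \<longleftrightarrow>
     f \<in> verts G \<rightarrow>\<^sub>E {-1, 1} \<and> (\<forall>v\<in>verts G. sum f (closed_nbhd G v) \<le> 1)"

definition maximal_negative_fun :: "('a, 'b) pre_digraph \<Rightarrow> ('a \<Rightarrow> real) \<Rightarrow> bool" where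
  "maximal_negative_fun G f \<longleftrightarrow>
     negative_fun G f \<and> \<not> (\<exists>g. negative_fun G g \<and> g \<noteq> f \<and> (\<forall>v\<in>verts G. f v \<le> g v))"

definition lower_against_number :: "('a, 'b) pre_digraph \<Rightarrow> real" where
  "lower_against_number G = Min ((\<lambda>f. sum f (verts G)) ` {f. maximal_negative_fun G f})"

text \<open>The minimum is taken over a finite nonempty set.\<close>

lemma finite_maximal_negative_fun:
  assumes "finite (verts G)"
  shows "finite {f. maximal_negative_fun G f}"
proof (rule finite_subset)
  show "{f. maximal_negative_fun G f} \<subseteq> (verts G \<rightarrow>\<^sub>E {-1, 1})"
    by (auto simp: maximal_negative_fun_def negative_fun_def)
  show "finite (verts G \<rightarrow>\<^sub>E {-1, 1 :: real})"
    using assms by (intro finite_PiE) auto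
qed

lemma maximal_negative_fun_exists:
  assumes fin: "finite (verts G)"
  shows "\<exists>f. maximal_negative_fun G f"
proof -
  let ?N = "{f. negative_fun G f}"
  let ?w = "\<lambda>f. sum f (verts G)"
  have "?N \<subseteq> (verts G \<rightarrow>\<^sub>E {-1, 1})"
    by (auto simp: negative_fun_def)
  then have finN: "finite ?N"
    by (rule finite_subset) (use fin in \<open>auto intro!: finite_PiE\<close>)
  have "negative_fun G (restrict (\<lambda>_. -1) (verts G))"
    unfolding negative_fun_def
  proof (intro conjI ballI)
    fix v assume "v \<in> verts G"
    then have "sum (restrict (\<lambda>_. -1) (verts G)) (closed_nbhd G v) \<le> (0::real)"
      by (intro sum_nonpos) (auto simp: closed_nbhd_def open_nbhd_def)
    then show "sum (restrict (\<lambda>_. -1) (verts G)) (closed_nbhd G v) \<le> (1::real)"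
      by simp
  qed auto
  then have ne: "?w ` ?N \<noteq> {}" by blast
  obtain f where f: "negative_fun G f" "?w f = Max (?w ` ?N)"
    using Max_in[OF finite_imageI[OF finN] ne] by auto
  have "g = f" if g: "negative_fun G g" and le: "\<forall>v\<in>verts G. f v \<le> g v" for g
  proof (rule ccontr)
    assume "g \<noteq> f"
    then obtain v where "v \<in> verts G" "f v \<noteq> g v"
      using f(1) g unfolding negative_fun_def by (metis PiE_ext)
    then have "?w f < ?w g"
      using fin le by (intro sum_strict_mono_ex1) (auto simp: less_le)
    moreover have "?w g \<le> Max (?w ` ?N)"
      using finN g by (intro Max_ge) auto
    ultimately show False using f(2) by simp
  qed
  then show ?thesis using f(1) unfolding maximal_negative_fun_def by blast
qed

text \<open>The claimed lower bound for order \<open>n\<close>, minimum degree \<open>d\<close> and maximum degree \<open>D\<close>.\<close>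

definition against_bound :: "nat \<Rightarrow> nat \<Rightarrow> nat \<Rightarrow> real" where
  "against_bound n d D =
     (if D \<ge> d + 1 \<or> (d = D \<and> odd D)
      then (1 - real D) / (1 + real D) * real n
      else (real D + 2 - (real D)\<^sup>2) / (real D + 2 + (real D)\<^sup>2) * real n)"

end

theory Submission
  imports Defs "HOL-Library.Countable"
begin

text \<open>
  Let \<open>P\<close> and \<open>M\<close> be the sets where a maximal negative function \<open>f\<close> is \<open>1\<close> and \<open>-1\<close>, and call \<open>u\<close>
  tight if \<open>f(N[u]) \<ge> 0\<close>. Maximality means that every vertex of \<open>M\<close> has a tight vertex in its
  closed neighbourhood. Let \<open>B\<close> be the set of tight vertices of \<open>M\<close>. A vertex of \<open>B\<close> accounts for
  itself and its neighbours in \<open>M\<close>, which are fewer than its neighbours in \<open>P\<close>; a tight vertex of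
  \<open>P\<close> need only account for its neighbours in \<open>M - B\<close>. Counting the edges between \<open>B\<close> and \<open>P\<close>
  from the side of \<open>P\<close> gives \<open>|M| \<le> \<Delta> |P|\<close>. In a regular graph of even degree \<open>2k\<close> parity
  improves this by the factor \<open>k / (k + 1)\<close>.

  Equality is attained when \<open>M\<close> splits into \<open>B\<close>, completely joined to \<open>P\<close>, and private
  \<open>M\<close>-neighbours of the vertices of \<open>B\<close>, which are joined up into (almost complete) graphs on
  \<open>\<Delta>\<close> vertices.
\<close>

section \<open>Neighbourhoods and the domination count\<close>

lemma finite_open_nbhd: "finite (verts G) \<Longrightarrow> finite (open_nbhd G v)"
  by (simp add: open_nbhd_def)

lemma closed_nbhd_subset: "v \<in> verts G \<Longrightarrow> closed_nbhd G v \<subseteq> verts G"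
  by (auto simp: closed_nbhd_def open_nbhd_def)

context graph
begin

lemma open_nbhd_sym:
  assumes "u \<in> open_nbhd G v" shows "v \<in> open_nbhd G u"
proof -
  have "v \<rightarrow> u" using assms by (simp add: open_nbhd_def)
  then have "u \<rightarrow> v" "v \<in> verts G"
    using sym_arcs by (auto simp: symmetric_def dest: symD adj_in_verts)
  then show ?thesis by (simp add: open_nbhd_def)
qed

lemma not_in_open_nbhd: "v \<notin> open_nbhd G v"
  by (auto simp: open_nbhd_def dest: adj_not_same)

lemma out_degree_eq_card_open_nbhd: "out_degree G v = card (open_nbhd G v)"
proof -
  have "inj_on (head G) (out_arcs G v)"
    by (auto simp: inj_on_def out_arcs_def arc_to_ends_def intro: no_multi_arcs)
  moreover have "head G ` out_arcs G v = open_nbhd G v"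
    by (auto simp: open_nbhd_def arcs_ends_conv image_iff)
  ultimately show ?thesis
    by (metis out_degree_def card_image)
qed

lemma sum_closed_nbhd:
  fixes f :: "'a \<Rightarrow> real"
  shows "sum f (closed_nbhd G v) = f v + sum f (open_nbhd G v)"
  unfolding closed_nbhd_def by (simp add: finite_open_nbhd not_in_open_nbhd)

text \<open>A charging argument: each tight vertex of \<open>M\<close> pays for what it covers by
  charging \<open>c\<close> along each of its edges to \<open>P\<close>, so that in total every
  vertex of \<open>P\<close> has to pay at most \<open>c * D\<close>. The factor \<open>c\<close> is
  kept as a parameter because both cases of the bound use the same count: \<open>c = 1\<close> in
  general, and \<open>c = k / (k + 1)\<close> for regular graphs of degree
  \<open>2 * k\<close>.\<close>

lemma card_dominated_le:
  fixes c :: real and D :: nat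
  assumes PM: "P \<union> M = verts G" "P \<inter> M = {}"
    and dom: "\<And>v. v \<in> M \<Longrightarrow> \<exists>u\<in>closed_nbhd G v. u \<in> T"
    and c: "0 \<le> c" "c \<le> 1"
    and B: "\<And>u. u \<in> M \<inter> T \<Longrightarrow> 1 + real (card (open_nbhd G u \<inter> M)) \<le> c * card (open_nbhd G u \<inter> P)"
    and A: "\<And>u. u \<in> P \<inter> T \<Longrightarrow> real (card (open_nbhd G u \<inter> M)) \<le> c * D"
    and deg: "\<And>u. u \<in> P \<Longrightarrow> card (open_nbhd G u) \<le> D"
  shows "card M \<le> c * D * card P"
proof -
  let ?N = "open_nbhd G"
  define A' where "A' = P \<inter> T"
  define B' where "B' = M \<inter> T"
  have fin [simp]: "finite P" "finite M" "finite A'" "finite B'"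
    using finite_verts PM(1) by (auto simp: A'_def B'_def intro: finite_subset)
  have finN [simp]: "finite (?N u)" for u by (simp add: finite_open_nbhd)
  \<comment> \<open>A vertex of \<open>B'\<close> covers itself, so the neighbourhoods are only
    needed on \<open>M - B'\<close>. A vertex there is not tight, hence its tight dominator is a
    proper neighbour.\<close>
  have "M \<subseteq> B' \<union> (\<Union>u\<in>B'. ?N u \<inter> (M - B')) \<union> (\<Union>u\<in>A'. ?N u \<inter> (M - B'))"
  proof
    fix v assume v: "v \<in> M"
    then obtain u where u: "u \<in> closed_nbhd G v" "u \<in> T" using dom by blast
    then have "u \<in> verts G" using v PM(1) closed_nbhd_subset[of v G] by auto
    then have "u \<in> A' \<or> u \<in> B'" using u PM by (auto simp: A'_def B'_def)
    moreover have "u = v \<or> v \<in> ?N u" using u open_nbhd_sym by (auto simp: closed_nbhd_def)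
    ultimately show "v \<in> B' \<union> (\<Union>u\<in>B'. ?N u \<inter> (M - B')) \<union> (\<Union>u\<in>A'. ?N u \<inter> (M - B'))"
      using v PM(2) by (auto simp: A'_def B'_def)
  qed
  then have "card M \<le> card (B' \<union> (\<Union>u\<in>B'. ?N u \<inter> (M - B')) \<union> (\<Union>u\<in>A'. ?N u \<inter> (M - B')))"
    by (intro card_mono) auto
  also have "\<dots> \<le> card B' + card (\<Union>u\<in>B'. ?N u \<inter> (M - B')) + card (\<Union>u\<in>A'. ?N u \<inter> (M - B'))"
    by (meson add_le_mono1 card_Un_le le_trans)
  also have "\<dots> \<le> card B' + (\<Sum>u\<in>B'. card (?N u \<inter> (M - B'))) + (\<Sum>u\<in>A'. card (?N u \<inter> (M - B')))"
    by (intro add_mono card_UN_le) auto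
  also have "\<dots> = (\<Sum>u\<in>B'. 1 + card (?N u \<inter> (M - B'))) + (\<Sum>u\<in>A'. card (?N u \<inter> (M - B')))"
    by (subst sum.distrib) simp
  finally have "real (card M) \<le> real \<dots>" by (simp only: of_nat_le_iff)
  also have "\<dots> = (\<Sum>u\<in>B'. 1 + real (card (?N u \<inter> (M - B')))) + (\<Sum>u\<in>A'. real (card (?N u \<inter> (M - B'))))"
    by simp
  also have "\<dots> \<le> (\<Sum>u\<in>B'. c * card (?N u \<inter> P)) + (\<Sum>u\<in>A'. real (card (?N u \<inter> (M - B'))))"
  proof (intro add_right_mono sum_mono)
    fix u assume "u \<in> B'"
    then have "1 + real (card (?N u \<inter> M)) \<le> c * card (?N u \<inter> P)" by (simp add: B B'_def)
    moreover have "card (?N u \<inter> (M - B')) \<le> card (?N u \<inter> M)" by (intro card_mono) auto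
    ultimately show "1 + real (card (?N u \<inter> (M - B'))) \<le> c * card (?N u \<inter> P)" by linarith
  qed
  \<comment> \<open>The edges between \<open>B'\<close> and \<open>P\<close> are counted from the
    other end.\<close>
  also have "(\<Sum>u\<in>B'. c * card (?N u \<inter> P)) = (\<Sum>p\<in>P. c * card (?N p \<inter> B'))"
  proof -
    have "(\<Sum>u\<in>B'. card (?N u \<inter> P)) = (\<Sum>u\<in>B'. \<Sum>p\<in>{p \<in> P. p \<in> ?N u}. 1)"
      by (auto intro!: sum.cong arg_cong[where f = card])
    also have "\<dots> = (\<Sum>p\<in>P. \<Sum>u\<in>{u \<in> B'. p \<in> ?N u}. 1)"
      by (intro sum.swap_restrict) auto
    also have "\<dots> = (\<Sum>p\<in>P. card (?N p \<inter> B'))"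
      by (auto intro!: sum.cong arg_cong[where f = card] dest: open_nbhd_sym)
    finally show ?thesis
      by (simp flip: sum_distrib_left of_nat_sum)
  qed
  also have "(\<Sum>u\<in>A'. real (card (?N u \<inter> (M - B')))) =
      (\<Sum>p\<in>P. if p \<in> A' then real (card (?N p \<inter> (M - B'))) else 0)"
    by (simp add: sum.inter_restrict[symmetric] A'_def Int_absorb1)
  also have "(\<Sum>p\<in>P. c * card (?N p \<inter> B')) + \<dots> \<le> (\<Sum>p\<in>P. c * D)"
    unfolding sum.distrib[symmetric]
  proof (rule sum_mono)
    fix p assume p: "p \<in> P"
    \<comment> \<open>A tight \<open>p\<close> pays for neighbours in \<open>B'\<close> and in
      \<open>M - B'\<close>; as \<open>c\<close> is at most 1, the total is at most the number of
      its neighbours in \<open>M\<close>, which \<open>A\<close> bounds. Any other \<open>p\<close>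
      pays only for neighbours in \<open>B'\<close>, and there the degree bound suffices.\<close>
    show "c * card (?N p \<inter> B') + (if p \<in> A' then real (card (?N p \<inter> (M - B'))) else 0) \<le> c * D"
    proof (cases "p \<in> A'")
      case True
      have "card (?N p \<inter> M) = card (?N p \<inter> B' \<union> ?N p \<inter> (M - B'))"
        by (rule arg_cong[where f = card]) (auto simp: B'_def)
      also have "\<dots> = card (?N p \<inter> B') + card (?N p \<inter> (M - B'))"
        by (rule card_Un_disjoint) auto
      finally have "c * card (?N p \<inter> B') + card (?N p \<inter> (M - B')) \<le> real (card (?N p \<inter> M))"
        using mult_right_mono[OF c(2), of "card (?N p \<inter> B')"] by simp
      then show ?thesis using A[of p] True by (simp add: A'_def)
    next
      case False
      have "card (?N p \<inter> B') \<le> card (?N p)" by (intro card_mono) auto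
      then have "real (card (?N p \<inter> B')) \<le> D" using deg[OF p] by linarith
      then show ?thesis using False c(1) by (simp add: mult_left_mono)
    qed
  qed
  finally show ?thesis by (simp add: mult.commute)
qed

end

section \<open>A local criterion for maximality\<close>

text \<open>Raising a single value at \<open>v\<close> from -1 to 1 adds 2 to the sums over exactly
  those closed neighbourhoods whose centre lies in that of \<open>v\<close>. The result stays
  negative unless one of these sums exceeds -1. Conversely, a larger function raises some
  \<open>v\<close>, and then it violates the condition at a tight vertex near
  \<open>v\<close>.\<close>

lemma maximal_negative_fun_iff:
  assumes fin: "finite (verts G)"
    and sym: "\<And>u v. u \<in> open_nbhd G v \<Longrightarrow> v \<in> open_nbhd G u"
  shows "maximal_negative_fun G f \<longleftrightarrow> negative_fun G f \<and>
    (\<forall>v\<in>verts G. f v = -1 \<longrightarrow> (\<exists>u\<in>closed_nbhd G v. sum f (closed_nbhd G u) > -1))"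
    (is "_ \<longleftrightarrow> _ \<and> ?tight")
proof (intro iffI conjI)
  assume max: "maximal_negative_fun G f"
  then show neg: "negative_fun G f" by (simp add: maximal_negative_fun_def)
  show ?tight
  proof (intro ballI impI, rule ccontr)
    fix v assume v: "v \<in> verts G" "f v = -1"
      and *: "\<not> (\<exists>u\<in>closed_nbhd G v. - 1 < sum f (closed_nbhd G u))"
    define g where "g = f(v := 1)"
    have "sum g (closed_nbhd G u) \<le> 1" if u: "u \<in> verts G" for u
    proof (cases "v \<in> closed_nbhd G u")
      case True
      then have "u \<in> closed_nbhd G v" using sym by (auto simp: closed_nbhd_def)
      then have "sum f (closed_nbhd G u) \<le> -1" using * by auto
      moreover have "finite (closed_nbhd G u)"
        using finite_open_nbhd[OF fin] by (simp add: closed_nbhd_def)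
      moreover from this have "sum g (closed_nbhd G u) = sum f (closed_nbhd G u) + 2"
        using True v by (simp add: g_def sum.remove[of _ v])
      ultimately show ?thesis by simp
    next
      case False
      then have "sum g (closed_nbhd G u) = sum f (closed_nbhd G u)"
        by (intro sum.cong) (auto simp: g_def)
      then show ?thesis using neg u by (simp add: negative_fun_def)
    qed
    moreover have "g \<in> verts G \<rightarrow>\<^sub>E {-1, 1}"
      using neg v by (auto simp: negative_fun_def g_def PiE_iff extensional_def)
    ultimately have "negative_fun G g" by (simp add: negative_fun_def)
    moreover have "g \<noteq> f" "\<forall>w\<in>verts G. f w \<le> g w" using v by (auto simp: g_def fun_eq_iff)
    ultimately show False using max by (auto simp: maximal_negative_fun_def)
  qed
next
  assume "negative_fun G f \<and> ?tight"
  then have neg: "negative_fun G f" and tight: ?tight by auto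
  have False if g: "negative_fun G g" "g \<noteq> f" and le: "\<forall>v\<in>verts G. f v \<le> g v" for g
  proof -
    obtain v where v: "v \<in> verts G" "f v \<noteq> g v"
      using neg g unfolding negative_fun_def by (metis PiE_ext)
    moreover have "f v \<in> {-1, 1}" "g v \<in> {-1, 1}"
      using neg g(1) v(1) unfolding negative_fun_def by (auto dest: PiE_mem)
    ultimately have fv: "f v = -1" "g v = 1" using le by force+
    then obtain u where u: "u \<in> closed_nbhd G v" "sum f (closed_nbhd G u) > -1"
      using tight v(1) by blast
    have uV: "u \<in> verts G" using u(1) v(1) closed_nbhd_subset[of v G] by auto
    have vu: "v \<in> closed_nbhd G u" using u(1) sym by (auto simp: closed_nbhd_def)
    have fin': "finite (closed_nbhd G u)"
      using finite_open_nbhd[OF fin] by (simp add: closed_nbhd_def)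
    have "sum f (closed_nbhd G u - {v}) \<le> sum g (closed_nbhd G u - {v})"
      using le closed_nbhd_subset[OF uV] by (intro sum_mono) auto
    then have "sum g (closed_nbhd G u) > 1"
      using u(2) fv by (simp add: sum.remove[OF fin' vu])
    then show False using g(1) uV by (auto simp: negative_fun_def)
  qed
  then show "maximal_negative_fun G f"
    using neg by (auto simp: maximal_negative_fun_def)
qed

section \<open>The lower bound for maximal negative functions\<close>

lemma sum_pm_one:
  fixes f :: "'a \<Rightarrow> real"
  assumes "finite S" "\<And>v. v \<in> S \<Longrightarrow> f v = -1 \<or> f v = 1"
  shows "sum f S = real (card {v\<in>S. f v = 1}) - real (card {v\<in>S. f v = -1})"
    and "card S = card {v\<in>S. f v = 1} + card {v\<in>S. f v = -1}"
proof -
  have S: "S = {v\<in>S. f v = 1} \<union> {v\<in>S. f v = -1}" using assms(2) by auto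
  have "sum f S = sum f {v\<in>S. f v = 1} + sum f {v\<in>S. f v = -1}"
    by (subst S, rule sum.union_disjoint) (use assms(1) in auto)
  then show "sum f S = real (card {v\<in>S. f v = 1}) - real (card {v\<in>S. f v = -1})"
    by simp
  show "card S = card {v\<in>S. f v = 1} + card {v\<in>S. f v = -1}"
    by (subst S, rule card_Un_disjoint) (use assms(1) in auto)
qed

text \<open>The weight is |P| - |M| and the order is |P| + |M|, so |M| \<le> r |P| yields the factor
  (1 - r) / (1 + r). The domination count gives r = D in the first case and r = D^2 / (D + 2) in the
  second.\<close>

lemma (in graph) maximal_negative_fun_sum_ge:
  assumes f: "maximal_negative_fun G f" and ne: "verts G \<noteq> {}"
  shows "against_bound (card (verts G)) (min_degree G) (max_degree G) \<le> sum f (verts G)"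
proof -
  let ?N = "open_nbhd G" and ?D = "max_degree G"
  define P where "P = {v \<in> verts G. f v = 1}"
  define M where "M = {v \<in> verts G. f v = -1}"
  define T where "T = {u \<in> verts G. sum f (closed_nbhd G u) > -1}"
  have pm: "f v = -1 \<or> f v = 1" if "v \<in> verts G" for v
    using f that unfolding maximal_negative_fun_def negative_fun_def by (auto dest: PiE_mem)
  have "real (card (verts G)) = real (card P) + real (card M)"
    and "sum f (verts G) = real (card P) - real (card M)"
    using sum_pm_one[of "verts G" f] pm by (simp_all add: P_def M_def)
  note cards = this
  have PM: "P \<union> M = verts G" "P \<inter> M = {}" using pm by (auto simp: P_def M_def)
  have sub: "?N u \<subseteq> verts G" for u by (auto simp: open_nbhd_def)
  have N: "sum f (?N u) = real (card (?N u \<inter> P)) - real (card (?N u \<inter> M))"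
    "card (?N u) = card (?N u \<inter> P) + card (?N u \<inter> M)" for u
  proof -
    have "{v \<in> ?N u. f v = 1} = ?N u \<inter> P" "{v \<in> ?N u. f v = -1} = ?N u \<inter> M"
      using sub by (auto simp: P_def M_def)
    then show "sum f (?N u) = real (card (?N u \<inter> P)) - real (card (?N u \<inter> M))"
      "card (?N u) = card (?N u \<inter> P) + card (?N u \<inter> M)"
      using sum_pm_one[of "?N u" f] pm sub by (auto simp: finite_open_nbhd subset_iff)
  qed
  have degs: "min_degree G \<le> card (?N u)" "card (?N u) \<le> ?D" if "u \<in> verts G" for u
    unfolding min_degree_def max_degree_def out_degree_eq_card_open_nbhd using that by auto
  have tightM: "card (?N u \<inter> M) < card (?N u \<inter> P)" if "u \<in> M \<inter> T" for u
    using that N(1)[of u] by (simp add: M_def T_def sum_closed_nbhd)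
  have tightP: "card (?N u \<inter> M) \<le> card (?N u \<inter> P) + 1" if "u \<in> P \<inter> T" for u
    using that N(1)[of u] by (simp add: P_def T_def sum_closed_nbhd)
  have dom: "\<exists>u\<in>closed_nbhd G v. u \<in> T" if v: "v \<in> M" for v
  proof -
    have "\<exists>u\<in>closed_nbhd G v. sum f (closed_nbhd G u) > -1"
      using f v maximal_negative_fun_iff[of G f] open_nbhd_sym by (auto simp: M_def)
    moreover have "closed_nbhd G v \<subseteq> verts G" using v closed_nbhd_subset[of v G] by (simp add: M_def)
    ultimately show ?thesis by (auto simp: T_def)
  qed
  have degP: "card (?N u) \<le> ?D" if "u \<in> P" for u using degs that by (auto simp: P_def)
  show ?thesis
  proof (cases "?D \<ge> min_degree G + 1 \<or> (min_degree G = ?D \<and> odd ?D)")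
    case True
    have "card M \<le> 1 * real ?D * card P"
    proof (rule card_dominated_le[OF PM, where T = T])
      show "1 + real (card (?N u \<inter> M)) \<le> 1 * real (card (?N u \<inter> P))" if "u \<in> M \<inter> T" for u
        using tightM[OF that] by simp
      show "real (card (?N u \<inter> M)) \<le> 1 * real ?D" if "u \<in> P \<inter> T" for u
        using degP[of u] N(2)[of u] that by simp
    qed (use dom degP in auto)
    then show ?thesis
      using True unfolding against_bound_def cards by (simp add: field_simps)
  next
    case False
    moreover have "min_degree G \<le> ?D" using ne degs by fastforce
    ultimately have eq: "min_degree G = ?D" and "even ?D" by auto
    then obtain k where k: "?D = 2 * k" by blast
    have reg: "card (?N u \<inter> P) + card (?N u \<inter> M) = 2 * k" if "u \<in> verts G" for u
      using degs[OF that] eq k N(2)[of u] by simp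
    \<comment> \<open>In degree \<open>2 * k\<close>, a tight vertex of \<open>M\<close> has fewer
      neighbours in \<open>M\<close> than in \<open>P\<close>, hence by parity at most
      \<open>k - 1\<close> against at least \<open>k + 1\<close>. Counting the vertex itself, the
      ratio is at most \<open>k / (k + 1)\<close>.\<close>
    define c where "c = real k / (real k + 1)"
    have "card M \<le> c * real ?D * card P"
    proof (rule card_dominated_le[OF PM, where T = T])
      fix u assume u: "u \<in> M \<inter> T"
      then have *: "card (?N u \<inter> M) + 1 \<le> k" "k + 1 \<le> card (?N u \<inter> P)"
        using tightM[OF u] reg[of u] by (auto simp: M_def)
      have "1 + real (card (?N u \<inter> M)) \<le> c * (real k + 1)" using * by (simp add: c_def)
      also have "\<dots> \<le> c * card (?N u \<inter> P)"
        using * by (intro mult_left_mono) (auto simp: c_def)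
      finally show "1 + real (card (?N u \<inter> M)) \<le> c * card (?N u \<inter> P)" .
    next
      fix u assume u: "u \<in> P \<inter> T"
      \<comment> \<open>Parity again: an excess of at most 1 of \<open>M\<close> over
        \<open>P\<close> in an even degree is no excess at all.\<close>
      then have "card (?N u \<inter> M) \<le> k" using tightP[OF u] reg[of u] by (auto simp: P_def)
      moreover have "real k * (real k + 1) \<le> real k * (2 * real k)"
        by (cases k) (auto intro!: mult_left_mono)
      then have "real k \<le> c * ?D" by (simp add: c_def k field_simps)
      ultimately show "real (card (?N u \<inter> M)) \<le> c * ?D" by simp
    qed (use dom degP in \<open>auto simp: c_def\<close>)
    then have M: "(k + 1) * real (card M) \<le> 2 * (real k)\<^sup>2 * card P"
      by (simp add: c_def k field_simps power2_eq_square)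
    have pos: "0 < real ?D + 2 + (real ?D)\<^sup>2" by (auto intro: add_pos_nonneg)
    \<comment> \<open>After cancellation this says (D + 2) |M| \<le> D^2 |P|, which is the fact
      \<open>M\<close> with D = 2k, up to a constant factor.\<close>
    have "(real ?D + 2 - (real ?D)\<^sup>2) * (real (card P) + real (card M)) \<le>
        (real (card P) - real (card M)) * (real ?D + 2 + (real ?D)\<^sup>2)"
      using M unfolding k by (simp add: algebra_simps power2_eq_square)
    then show ?thesis
      using eq \<open>even ?D\<close> pos unfolding against_bound_def cards by (simp add: pos_divide_le_eq)
  qed
qed

lemma (in graph) lower_against_number_ge:
  assumes "verts G \<noteq> {}"
  shows "against_bound (card (verts G)) (min_degree G) (max_degree G) \<le> lower_against_number G"
  unfolding lower_against_number_def
  using finite_maximal_negative_fun[of G] maximal_negative_fun_exists[of G]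
    maximal_negative_fun_sum_ge[OF _ assms]
  by (subst Min_ge_iff) auto

section \<open>Graphs on the natural numbers given by a relation\<close>

text \<open>Sharpness is stated for graphs on \<open>nat\<close>, but the extremal graphs are easier
  to describe on a structured vertex type; the injection \<open>to_nat\<close> carries them
  over.\<close>

definition nat_graph :: "'v::countable set \<Rightarrow> ('v \<Rightarrow> 'v \<Rightarrow> bool) \<Rightarrow> nat pair_pre_digraph" where
  "nat_graph V R = \<lparr>pverts = to_nat ` V,
     parcs = {(to_nat x, to_nat y) | x y. x \<in> V \<and> y \<in> V \<and> R x y}\<rparr>"

lemma pverts_nat_graph [simp]: "pverts (nat_graph V R) = to_nat ` V"
  by (simp add: nat_graph_def)

lemma parcs_nat_graph:
  "(to_nat x, to_nat y) \<in> parcs (nat_graph V R) \<longleftrightarrow> x \<in> V \<and> y \<in> V \<and> R x y"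
  by (auto simp: nat_graph_def)

lemma card_nat_graph: "card (pverts (nat_graph V R)) = card V"
  by (simp add: card_image inj_on_def)

lemma pair_graph_nat_graph:
  assumes "finite V" "symp R" "irreflp R"
  shows "pair_graph (nat_graph V R)"
proof
  show "finite (parcs (nat_graph V R))"
  proof (rule finite_subset)
    show "parcs (nat_graph V R) \<subseteq> to_nat ` V \<times> to_nat ` V" by (auto simp: nat_graph_def)
  qed (use assms in auto)
  show "symmetric (nat_graph V R)"
    using sympD[OF assms(2)] by (auto simp: symmetric_def sym_def nat_graph_def)
  show "fst e \<noteq> snd e" if "e \<in> parcs (nat_graph V R)" for e
    using that irreflpD[OF assms(3)] by (auto simp: nat_graph_def)
qed (use assms in \<open>auto simp: nat_graph_def\<close>)

lemma open_nbhd_nat_graph: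
  assumes "x \<in> V"
  shows "open_nbhd (nat_graph V R) (to_nat x) = to_nat ` {y \<in> V. R x y}"
  using assms by (auto simp: open_nbhd_def parcs_nat_graph)

lemma closed_nbhd_nat_graph:
  assumes "x \<in> V"
  shows "closed_nbhd (nat_graph V R) (to_nat x) = to_nat ` insert x {y \<in> V. R x y}"
  using assms by (simp add: closed_nbhd_def open_nbhd_nat_graph)

text \<open>By symmetry, paths from one root to all vertices can be reversed and composed into paths
  between any two vertices.\<close>

lemma connected_nat_graph:
  assumes graph: "pair_graph (nat_graph V R)" and root: "r \<in> V"
    and path: "\<And>x. x \<in> V \<Longrightarrow> (\<lambda>x y. x \<in> V \<and> y \<in> V \<and> R x y)\<^sup>*\<^sup>* r x"
  shows "Digraph_Component.connected (nat_graph V R)"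
proof -
  interpret pair_graph "nat_graph V R" by (fact graph)
  have *: "to_nat r \<rightarrow>\<^sup>*\<^bsub>nat_graph V R\<^esub> to_nat x" if "x \<in> V" for x
    using path[OF that]
  proof (induction rule: rtranclp_induct)
    case base
    show ?case using root by (intro reachable_refl) simp
  next
    case (step y z)
    then show ?case by (intro reachable_adj_trans[OF step.IH]) (simp add: parcs_nat_graph)
  qed
  show ?thesis
  proof -
    have "strongly_connected (nat_graph V R)"
    proof (rule strongly_connectedI)
      show "verts (nat_graph V R) \<noteq> {}" using root by auto
      fix u v assume "u \<in> verts (nat_graph V R)" "v \<in> verts (nat_graph V R)"
      then show "u \<rightarrow>\<^sup>*\<^bsub>nat_graph V R\<^esub> v"
        using * reachable_trans[of u "to_nat r" v] symmetric_reachable'[of "to_nat r" u] by auto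
    qed
    then show ?thesis
      using reachable_mk_symmetricI by (auto simp: Digraph_Component.connected_def strongly_connected_def)
  qed
qed

lemma degree_nat_graph:
  assumes "pair_graph (nat_graph V R)"
  shows "min_degree (nat_graph V R) = Min ((\<lambda>x. card {y \<in> V. R x y}) ` V)"
    and "max_degree (nat_graph V R) = Max ((\<lambda>x. card {y \<in> V. R x y}) ` V)"
proof -
  interpret pair_graph "nat_graph V R" by (fact assms)
  have "out_degree (nat_graph V R) (to_nat x) = card {y \<in> V. R x y}" if "x \<in> V" for x
    using that by (simp add: out_degree_eq_card_open_nbhd open_nbhd_nat_graph card_image inj_on_def)
  then have "out_degree (nat_graph V R) ` verts (nat_graph V R) = (\<lambda>x. card {y \<in> V. R x y}) ` V"
    by (auto simp: image_iff)
  then show "min_degree (nat_graph V R) = Min ((\<lambda>x. card {y \<in> V. R x y}) ` V)"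
    and "max_degree (nat_graph V R) = Max ((\<lambda>x. card {y \<in> V. R x y}) ` V)"
    by (simp_all add: min_degree_def max_degree_def)
qed

text \<open>The local criterion certifies that \<open>g\<close>, carried over by
  \<open>to_nat\<close>, is a maximal negative function, and the minimum is at most its
  weight.\<close>

lemma lower_against_number_nat_graph_le:
  fixes g :: "'v::countable \<Rightarrow> real"
  assumes graph: "pair_graph (nat_graph V R)"
    and g: "\<And>x. x \<in> V \<Longrightarrow> g x = -1 \<or> g x = 1"
    and neg: "\<And>x. x \<in> V \<Longrightarrow> g x + sum g {y \<in> V. R x y} \<le> 1"
    and tight: "\<And>x. x \<in> V \<Longrightarrow> g x = -1 \<Longrightarrow>
      \<exists>u\<in>V. (u = x \<or> R x u) \<and> g u + sum g {y \<in> V. R u y} > -1"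
  shows "lower_against_number (nat_graph V R) \<le> sum g V"
proof -
  interpret pair_graph "nat_graph V R" by (fact graph)
  define f where "f = restrict (\<lambda>n. g (from_nat n)) (to_nat ` V)"
  have f: "f (to_nat x) = g x" if "x \<in> V" for x using that by (simp add: f_def)
  have sum_f: "sum f (to_nat ` S) = sum g S" if "S \<subseteq> V" for S
    using that f by (subst sum.reindex) (auto intro!: sum.cong simp: inj_on_def)
  have sum_closed: "sum f (closed_nbhd (nat_graph V R) (to_nat x)) = g x + sum g {y \<in> V. R x y}"
    if "x \<in> V" for x
    using that f sum_f[of "{y \<in> V. R x y}"]
    by (simp add: sum_closed_nbhd open_nbhd_nat_graph)
  have "negative_fun (nat_graph V R) f"
    unfolding negative_fun_def using g neg f
    by (auto simp: sum_closed) (auto simp: f_def)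
  moreover have "\<exists>u\<in>closed_nbhd (nat_graph V R) v. sum f (closed_nbhd (nat_graph V R) u) > -1"
    if v: "v \<in> verts (nat_graph V R)" "f v = -1" for v
  proof -
    obtain x where x: "x \<in> V" "v = to_nat x" using v by auto
    then obtain u where "u \<in> V" "u = x \<or> R x u" "g u + sum g {y \<in> V. R u y} > -1"
      using v f tight by metis
    then show ?thesis
      using x by (intro bexI[of _ "to_nat u"]) (simp add: sum_closed, auto simp: closed_nbhd_nat_graph)
  qed
  ultimately have "maximal_negative_fun (nat_graph V R) f"
    using maximal_negative_fun_iff[of "nat_graph V R" f] open_nbhd_sym finite_verts by simp
  then have "lower_against_number (nat_graph V R) \<le> sum f (verts (nat_graph V R))"
    unfolding lower_against_number_def using finite_maximal_negative_fun[of "nat_graph V R"] finite_verts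
    by (intro Min_le) auto
  then show ?thesis using sum_f[of V] by simp
qed

section \<open>The extremal grid graphs\<close>

text \<open>
  The extremal graphs: \<open>p\<close> hubs completely joined to \<open>D\<close> columns, and \<open>q\<close> rows of \<open>D\<close> cells, one in
  each column. Each row is a complete graph, except that in row \<open>0\<close> the edges from cell \<open>0\<close> to the
  cells \<open>i \<ge> d\<close> are missing, which gives cell \<open>0\<close> degree \<open>d\<close>.
\<close>

datatype grid_vertex = Hub nat | Column nat | Cell nat nat

instance grid_vertex :: countable by countable_datatype

fun grid_adj :: "nat \<Rightarrow> grid_vertex \<Rightarrow> grid_vertex \<Rightarrow> bool" where
  "grid_adj d (Hub a) (Column i) \<longleftrightarrow> True"
| "grid_adj d (Column i) (Hub a) \<longleftrightarrow> True"
| "grid_adj d (Column i) (Cell i' j) \<longleftrightarrow> i = i'"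
| "grid_adj d (Cell i' j) (Column i) \<longleftrightarrow> i = i'"
| "grid_adj d (Cell i j) (Cell i' j') \<longleftrightarrow>
     j = j' \<and> i \<noteq> i' \<and> \<not> (j = 0 \<and> (i = 0 \<and> d \<le> i' \<or> i' = 0 \<and> d \<le> i))"
| "grid_adj d _ _ \<longleftrightarrow> False"

definition grid_verts :: "nat \<Rightarrow> nat \<Rightarrow> nat \<Rightarrow> grid_vertex set" where
  "grid_verts p q D = Hub ` {..<p} \<union> Column ` {..<D} \<union> (\<lambda>(i, j). Cell i j) ` ({..<D} \<times> {..<q})"

abbreviation grid_nbhd :: "nat \<Rightarrow> nat \<Rightarrow> nat \<Rightarrow> nat \<Rightarrow> grid_vertex \<Rightarrow> grid_vertex set" where
  "grid_nbhd d p q D x \<equiv> {y \<in> grid_verts p q D. grid_adj d x y}"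

text \<open>The extremal function: the hubs form \<open>P\<close>, the columns are the tight
  vertices of \<open>M\<close>, and the cells are their private neighbours in
  \<open>M\<close>.\<close>

fun grid_weight :: "grid_vertex \<Rightarrow> real" where
  "grid_weight (Hub a) = 1"
| "grid_weight (Column i) = -1"
| "grid_weight (Cell i j) = -1"

lemma mem_grid_verts [simp]:
  "Hub a \<in> grid_verts p q D \<longleftrightarrow> a < p"
  "Column i \<in> grid_verts p q D \<longleftrightarrow> i < D"
  "Cell i j \<in> grid_verts p q D \<longleftrightarrow> i < D \<and> j < q"
  by (auto simp: grid_verts_def)

lemma finite_grid_verts: "finite (grid_verts p q D)"
  by (simp add: grid_verts_def)

lemma symp_grid_adj: "symp (grid_adj d)"
proof (rule sympI)
  show "grid_adj d y x" if "grid_adj d x y" for x y using that by (cases x; cases y) auto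
qed

lemma irreflp_grid_adj: "irreflp (grid_adj d)"
proof (rule irreflpI)
  show "\<not> grid_adj d x x" for x by (cases x) auto
qed

lemma
  shows card_grid_verts: "card (grid_verts p q D) = p + D + D * q"
    and sum_grid_weight: "sum grid_weight (grid_verts p q D) = real p - real D - real D * real q"
proof -
  have inj: "inj_on (\<lambda>(i, j). Cell i j) S" "inj_on Hub A" "inj_on Column A" for S A
    by (auto simp: inj_on_def)
  have disj: "Hub ` {..<p} \<inter> Column ` {..<D} = {}"
    "(Hub ` {..<p} \<union> Column ` {..<D}) \<inter> (\<lambda>(i, j). Cell i j) ` ({..<D} \<times> {..<q}) = {}"
    by auto
  show "card (grid_verts p q D) = p + D + D * q"
    unfolding grid_verts_def using disj inj
    by (simp add: card_Un_disjoint card_image)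
  show "sum grid_weight (grid_verts p q D) = real p - real D - real D * real q"
    unfolding grid_verts_def using disj inj
    by (simp add: sum.union_disjoint sum.reindex case_prod_unfold)
qed

lemma grid_nbhd_Hub: "grid_nbhd d p q D (Hub a) = Column ` {..<D}"
proof (rule set_eqI)
  show "y \<in> grid_nbhd d p q D (Hub a) \<longleftrightarrow> y \<in> Column ` {..<D}" for y by (cases y) auto
qed

lemma grid_nbhd_Column:
  assumes "i < D"
  shows "grid_nbhd d p q D (Column i) = Hub ` {..<p} \<union> Cell i ` {..<q}"
proof (rule set_eqI)
  show "y \<in> grid_nbhd d p q D (Column i) \<longleftrightarrow> y \<in> Hub ` {..<p} \<union> Cell i ` {..<q}" for y
    using assms by (cases y) auto
qed

lemma grid_nbhd_Cell:
  assumes "i < D" "j < q"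
  shows "grid_nbhd d p q D (Cell i j) = insert (Column i) ((\<lambda>i'. Cell i' j) `
    {i' \<in> {..<D} - {i}. \<not> (j = 0 \<and> (i = 0 \<and> d \<le> i' \<or> i' = 0 \<and> d \<le> i))})"
    (is "_ = ?S")
proof (rule set_eqI)
  show "y \<in> grid_nbhd d p q D (Cell i j) \<longleftrightarrow> y \<in> ?S" for y
    using assms by (cases y) auto
qed

lemma card_grid_nbhd_Hub: "card (grid_nbhd d p q D (Hub a)) = D"
  unfolding grid_nbhd_Hub by (simp add: card_image inj_on_def)

lemma sum_grid_nbhd_Hub: "sum grid_weight (grid_nbhd d p q D (Hub a)) = - real D"
  unfolding grid_nbhd_Hub by (simp add: sum.reindex inj_on_def)

lemma card_grid_nbhd_Column:
  assumes "i < D" shows "card (grid_nbhd d p q D (Column i)) = p + q"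
  unfolding grid_nbhd_Column[OF assms]
  by (subst card_Un_disjoint) (auto simp: card_image inj_on_def)

lemma sum_grid_nbhd_Column:
  assumes "i < D" shows "sum grid_weight (grid_nbhd d p q D (Column i)) = real p - real q"
  unfolding grid_nbhd_Column[OF assms]
  by (subst sum.union_disjoint) (auto simp: sum.reindex inj_on_def)

lemma card_grid_nbhd_Cell:
  assumes "i < D" "j < q"
  shows "card (grid_nbhd d p q D (Cell i j)) =
    Suc (card {i' \<in> {..<D} - {i}. \<not> (j = 0 \<and> (i = 0 \<and> d \<le> i' \<or> i' = 0 \<and> d \<le> i))})"
  unfolding grid_nbhd_Cell[OF assms]
  by (subst card_insert_disjoint) (auto simp: card_image inj_on_def)

lemma card_grid_nbhd_Cell_bounds:
  assumes ij: "i < D" "j < q" and d: "1 \<le> d" "d \<le> D"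
  shows "d \<le> card (grid_nbhd d p q D (Cell i j))" "card (grid_nbhd d p q D (Cell i j)) \<le> D"
proof -
  let ?S = "{i' \<in> {..<D} - {i}. \<not> (j = 0 \<and> (i = 0 \<and> d \<le> i' \<or> i' = 0 \<and> d \<le> i))}"
  have "card ?S \<le> card ({..<D} - {i})" by (intro card_mono) auto
  then show "card (grid_nbhd d p q D (Cell i j)) \<le> D"
    using ij by (simp add: card_grid_nbhd_Cell)
  have "d - 1 \<le> card ?S"
  \<comment> \<open>One neighbour is the column, so \<open>d - 1\<close> cells must be found. A cell
    with \<open>d \<le> i\<close> may have lost its edge to cell 0 but keeps cells 1 to
    \<open>d - 1\<close>; a cell with \<open>i < d\<close> keeps all others below
    \<open>d\<close>.\<close>
  proof (cases "d \<le> i")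
    case True
    have "card ({0<..<d}) \<le> card ?S" using True ij by (intro card_mono) auto
    then show ?thesis by simp
  next
    case False
    have "card ({..<d} - {i}) \<le> card ?S" using False d by (intro card_mono) auto
    then show ?thesis using False by simp
  qed
  then show "d \<le> card (grid_nbhd d p q D (Cell i j))"
    using ij by (simp add: card_grid_nbhd_Cell)
qed

lemma card_grid_nbhd_Cell_0:
  assumes "0 < q" "1 \<le> d" "d \<le> D"
  shows "card (grid_nbhd d p q D (Cell 0 0)) = d"
proof -
  have "{i' \<in> {..<D} - {0}. \<not> (d \<le> i' \<or> i' = 0 \<and> d \<le> 0)} = {0<..<d}"
    using assms by auto
  then show ?thesis using assms by (subst card_grid_nbhd_Cell) auto
qed

lemma sum_grid_nbhd_Cell_nonpos:
  assumes "i < D" "j < q"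
  shows "sum grid_weight (grid_nbhd d p q D (Cell i j)) \<le> 0"
  unfolding grid_nbhd_Cell[OF assms] by (rule sum_nonpos) auto

definition grid_graph :: "nat \<Rightarrow> nat \<Rightarrow> nat \<Rightarrow> nat \<Rightarrow> nat pair_pre_digraph" where
  "grid_graph d p q D = nat_graph (grid_verts p q D) (grid_adj d)"

lemma pair_graph_grid_graph: "pair_graph (grid_graph d p q D)"
  unfolding grid_graph_def
  by (intro pair_graph_nat_graph finite_grid_verts symp_grid_adj irreflp_grid_adj)

text \<open>Every hub and every cell is adjacent to a column, and every column to
  \<open>Hub 0\<close>. With \<open>D = 0\<close> there are neither columns nor cells, so a single
  hub is required.\<close>

lemma connected_grid_graph:
  assumes "0 < p" "0 < D \<or> p = 1"
  shows "Digraph_Component.connected (grid_graph d p q D)"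
  unfolding grid_graph_def
proof (rule connected_nat_graph)
  let ?R = "\<lambda>x y. x \<in> grid_verts p q D \<and> y \<in> grid_verts p q D \<and> grid_adj d x y"
  show "pair_graph (nat_graph (grid_verts p q D) (grid_adj d))"
    using pair_graph_grid_graph by (simp add: grid_graph_def)
  show "Hub 0 \<in> grid_verts p q D" using assms by simp
  have col: "?R\<^sup>*\<^sup>* (Hub 0) (Column i)" if "i < D" for i
    using that assms by (intro r_into_rtranclp) auto
  show "?R\<^sup>*\<^sup>* (Hub 0) x" if "x \<in> grid_verts p q D" for x
  proof (cases x)
    case (Hub a)
    show ?thesis
    proof (cases "a = 0")
      case False
      then have "0 < D" using that assms Hub by auto
      then show ?thesis using Hub that by (intro rtranclp.rtrancl_into_rtrancl[OF col[of 0]]) auto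
    qed (use Hub in simp)
  next
    case (Column i)
    then show ?thesis using col that by simp
  next
    case (Cell i j)
    then show ?thesis using that by (intro rtranclp.rtrancl_into_rtrancl[OF col[of i]]) auto
  qed
qed

text \<open>Hubs have degree \<open>D\<close>, columns \<open>p + q\<close>, and cells between
  \<open>d\<close> and \<open>D\<close>. The minimum \<open>d\<close> is attained at a column if
  \<open>d = p + q\<close>, and otherwise at \<open>Cell 0 0\<close>, which exists when
  \<open>0 < q\<close>.\<close>

lemma degree_grid_graph:
  assumes "0 < p" "d \<le> p + q" "p + q \<le> D"
    and "1 \<le> d" "d \<le> D"
    and "d = p + q \<or> 0 < q"
  shows "min_degree (grid_graph d p q D) = d" "max_degree (grid_graph d p q D) = D"
proof -
  let ?deg = "\<lambda>x. card (grid_nbhd d p q D x)" and ?V = "grid_verts p q D"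
  have graph: "pair_graph (nat_graph ?V (grid_adj d))"
    using pair_graph_grid_graph by (simp add: grid_graph_def)
  have bounds: "d \<le> ?deg x \<and> ?deg x \<le> D" if "x \<in> ?V" for x
    using that assms
    by (cases x) (simp_all add: card_grid_nbhd_Hub card_grid_nbhd_Column card_grid_nbhd_Cell_bounds)
  have "D \<in> ?deg ` ?V"
    using assms(1) by (intro image_eqI[of _ _ "Hub 0"]) (simp_all add: card_grid_nbhd_Hub)
  then show "max_degree (grid_graph d p q D) = D"
    unfolding grid_graph_def degree_nat_graph(2)[OF graph]
    using bounds by (intro Max_eqI) (auto simp: finite_grid_verts)
  have "d \<in> ?deg ` ?V"
  proof (cases "d = p + q")
    case True
    then show ?thesis
      using assms by (intro image_eqI[of _ _ "Column 0"]) (simp_all add: card_grid_nbhd_Column)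
  next
    case False
    then show ?thesis
      using assms by (intro image_eqI[of _ _ "Cell 0 0"]) (simp_all add: card_grid_nbhd_Cell_0)
  qed
  then show "min_degree (grid_graph d p q D) = d"
    unfolding grid_graph_def degree_nat_graph(1)[OF graph]
    using bounds by (intro Min_eqI) (auto simp: finite_grid_verts)
qed

text \<open>A closed neighbourhood of a column has weight \<open>p - q - 1\<close>, which is 0 or 1:
  small enough for negativity and large enough for tightness. Every column dominates itself and its
  cells.\<close>

lemma lower_against_number_grid_graph_le:
  assumes "p = q + 1 \<or> p = q + 2"
  shows "lower_against_number (grid_graph d p q D) \<le> real p - real D - real D * real q"
  unfolding grid_graph_def sum_grid_weight[symmetric]
proof (rule lower_against_number_nat_graph_le)
  let ?V = "grid_verts p q D"
  show "pair_graph (nat_graph ?V (grid_adj d))"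
    using pair_graph_grid_graph by (simp add: grid_graph_def)
  show "grid_weight x = -1 \<or> grid_weight x = 1" for x by (cases x) auto
  show "grid_weight x + sum grid_weight (grid_nbhd d p q D x) \<le> 1" if "x \<in> ?V" for x
  proof (cases x)
    case (Cell i j)
    then show ?thesis using that sum_grid_nbhd_Cell_nonpos[of i D j q p d] by simp
  qed (use that assms in \<open>auto simp: sum_grid_nbhd_Hub sum_grid_nbhd_Column\<close>)
  have col: "grid_weight (Column i) + sum grid_weight (grid_nbhd d p q D (Column i)) > -1"
    if "i < D" for i
    using that assms by (auto simp: sum_grid_nbhd_Column)
  show "\<exists>u\<in>?V. (u = x \<or> grid_adj d x u) \<and>
      grid_weight u + sum grid_weight (grid_nbhd d p q D u) > -1"
    if "x \<in> ?V" "grid_weight x = -1" for x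
  proof (cases x)
    case (Column i)
    then show ?thesis using that col by (intro bexI[of _ x]) auto
  next
    case (Cell i j)
    then show ?thesis using that col by (intro bexI[of _ "Column i"]) auto
  qed (use that in simp)
qed

lemma card_grid_graph: "card (pverts (grid_graph d p q D)) = p + D + D * q"
  by (simp add: grid_graph_def card_nat_graph card_grid_verts del: pverts_nat_graph)

section \<open>The bound for connected graphs and its sharpness\<close>

lemma connected_verts_nonempty: "Digraph_Component.connected G \<Longrightarrow> verts G \<noteq> {}"
  by (auto simp: connected_conv)

lemma lower_against_number_bound:
  fixes G :: "'a pair_pre_digraph"
  assumes "pair_graph G" "Digraph_Component.connected (with_proj G)"
  shows "against_bound (card (pverts G)) (min_degree (with_proj G)) (max_degree (with_proj G))
    \<le> lower_against_number (with_proj G)"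
proof -
  interpret pair_graph G by (fact assms(1))
  show ?thesis using lower_against_number_ge connected_verts_nonempty[OF assms(2)] by simp
qed

text \<open>The general bound and the explicit function on a grid graph enclose the minimum, so it
  remains to choose \<open>p\<close> and \<open>q\<close> such that the two agree. A connected graph
  with an isolated vertex is that vertex alone, so \<open>d = 0\<close> is paired only with
  \<open>D = 0\<close>.\<close>

lemma lower_against_number_sharp:
  assumes "d \<le> D" "1 \<le> d \<or> D = 0"
  shows "\<exists>H :: nat pair_pre_digraph. pair_graph H \<and> Digraph_Component.connected (with_proj H) \<and>
    min_degree (with_proj H) = d \<and> max_degree (with_proj H) = D \<and>
    lower_against_number (with_proj H) = against_bound (card (pverts H)) d D"
proof -
  have grid: ?thesis
    if pq: "p = q + 1 \<or> p = q + 2" and D: "0 < D \<or> p = 1"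
      and deg: "min_degree (grid_graph d p q D) = d" "max_degree (grid_graph d p q D) = D"
      and bound: "against_bound (p + D + D * q) d D = real p - real D - real D * real q"
    for p q
  proof -
    let ?H = "grid_graph d p q D"
    have conn: "Digraph_Component.connected ?H" using pq D by (intro connected_grid_graph) auto
    have "against_bound (card (pverts ?H)) d D \<le> lower_against_number ?H"
      using lower_against_number_bound[OF pair_graph_grid_graph conn] deg by simp
    moreover have "lower_against_number ?H \<le> against_bound (card (pverts ?H)) d D"
      using lower_against_number_grid_graph_le[OF pq] bound by (simp add: card_grid_graph)
    ultimately show ?thesis
      using pair_graph_grid_graph conn deg by (intro exI[of _ ?H]) auto
  qed
  consider "D = 0" | "1 \<le> d" "d < D \<or> odd D" | "1 \<le> d" "d = D" "even D"
    using assms by linarith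
  then show ?thesis
  proof cases
    case 1
    \<comment> \<open>The graph is a single hub; its degrees are computed directly because
      \<open>degree_grid_graph\<close> asks for \<open>1 \<le> d\<close>.\<close>
    have graph: "pair_graph (nat_graph (grid_verts 1 0 0) (grid_adj d))"
      using pair_graph_grid_graph[of d 1 0 0] by (simp add: grid_graph_def)
    have "grid_verts 1 0 0 = {Hub 0}" by (auto simp: grid_verts_def)
    then have img: "(\<lambda>x. card (grid_nbhd d 1 0 0 x)) ` grid_verts 1 0 0 = {0}"
      using card_grid_nbhd_Hub[of 1 0 0 d 0] by simp
    have "min_degree (grid_graph d 1 0 0) = 0" "max_degree (grid_graph d 1 0 0) = 0"
      unfolding grid_graph_def degree_nat_graph[OF graph] img by simp_all
    then have "min_degree (grid_graph d 1 0 D) = d" "max_degree (grid_graph d 1 0 D) = D"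
      using 1 assms by simp_all
    then show ?thesis
      by (rule grid[rotated 2]) (use 1 assms in \<open>auto simp: against_bound_def\<close>)
  next
    case 2
    \<comment> \<open>With \<open>p = q + 1\<close> the order is \<open>(q + 1) * (D + 1)\<close>
      and the weight \<open>(q + 1) * (1 - D)\<close>, for any \<open>q\<close>. This
      \<open>q\<close> puts the column degree \<open>2 * q + 1\<close> between \<open>d\<close> and
      \<open>D\<close>: if \<open>d = 2 * q\<close>, then \<open>d < D\<close>, since
      \<open>d = D\<close> would be odd.\<close>
    define q where "q = d div 2"
    have d: "d = 2 * q \<or> d = 2 * q + 1" unfolding q_def by linarith
    then have "2 * q + 1 \<le> D" using 2 assms by (auto elim!: oddE)
    then have deg: "min_degree (grid_graph d (q + 1) q D) = d" "max_degree (grid_graph d (q + 1) q D) = D"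
      using d 2 assms degree_grid_graph[of "q + 1" d q D] by auto
    have "against_bound (q + 1 + D + D * q) d D =
        (1 - real D) / (1 + real D) * real (q + 1 + D + D * q)"
      using 2 assms by (auto simp: against_bound_def)
    also have "\<dots> = real (q + 1) - real D - real D * real q"
      by (simp add: field_simps)
    finally show ?thesis using 2 assms deg by (intro grid[of "q + 1" q]) auto
  next
    case 3
    \<comment> \<open>With \<open>p = q + 2\<close> the column degree \<open>p + q\<close> equals
      \<open>D\<close>, and \<open>d = D\<close> leaves the rows complete, so the graph is
      regular.\<close>
    then obtain q where q: "D = 2 * (q + 1)" by (metis Suc_eq_plus1 evenE mult_0_right not0_implies_Suc not_one_le_zero)
    then have deg: "min_degree (grid_graph d (q + 2) q D) = d" "max_degree (grid_graph d (q + 2) q D) = D"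
      using 3 degree_grid_graph[of "q + 2" d q D] by auto
    have "against_bound (q + 2 + D + D * q) d D =
        (real D + 2 - (real D)\<^sup>2) / (real D + 2 + (real D)\<^sup>2) * real (q + 2 + D + D * q)"
      using 3 by (auto simp: against_bound_def)
    also have "real (q + 2 + D + D * q) = (real D + 2 + (real D)\<^sup>2) / 2"
      unfolding q by (simp add: field_simps power2_eq_square)
    also have "(real D + 2 - (real D)\<^sup>2) / (real D + 2 + (real D)\<^sup>2) * \<dots> =
        (real D + 2 - (real D)\<^sup>2) / 2"
    proof -
      have "0 < real D + 2 + (real D)\<^sup>2" by (auto intro: add_pos_nonneg)
      then show ?thesis by simp
    qed
    also have "\<dots> = real (q + 2) - real D - real D * real q"
      unfolding q by (simp add: field_simps power2_eq_square)
    finally show ?thesis using 3 deg by (intro grid[of "q + 2" q]) auto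
  qed
qed

theorem theorem2p2:
  shows "(\<forall>G :: 'a pair_pre_digraph. pair_graph G \<and> Digraph_Component.connected (with_proj G) \<longrightarrow>
            lower_against_number (with_proj G) \<ge>
              against_bound (card (pverts G)) (min_degree (with_proj G)) (max_degree (with_proj G))) \<and>
         (\<forall>d D :: nat. d \<le> D \<and> (1 \<le> d \<or> D = 0) \<longrightarrow>
            (\<exists>H :: nat pair_pre_digraph. pair_graph H \<and> Digraph_Component.connected (with_proj H) \<and>
               min_degree (with_proj H) = d \<and> max_degree (with_proj H) = D \<and>
               lower_against_number (with_proj H) = against_bound (card (pverts H)) d D))"
  using lower_against_number_bound lower_against_number_sharp by blast

end
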